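(* For every $k\ge2$, the integrality gap of (LP-MUHV), the linear programming relaxation of the MUHV problem with $k$ colors, has a lower bound of $2-\frac2k$: $$\sup_{I}\ \frac{\mathrm{OPT}(\mathrm{MUHV})(I)}{\mathrm{OPT}(\text{LP-MUHV})(I)}\ \ge\ 2-\frac2k,$$ where the supremum is over all MUHV instances $I$ with $k$ colors and $\mathrm{OPT}(\text{LP-MUHV})(I)>0$.
   Context: **MUHV problem.** An instance consists of a finite undirected graph $G=(V,E)$, $V=\{v_1,\dots,v_n\}$, non-negative vertex weights $w_j=w(v_j)$, a color set $C=\{1,\dots,k\}$, and a partial vertex coloring $c$ with colors in $C$ in which every color is used on at least one vertex. $\mathrm{OPT}(\mathrm{MUHV})(I)$ is the minimum, over all colorings of $V$ extending $c$, of the total weight of unhappy vertices (vertices whose color differs from that of at least one neighbor). **(LP-MUHV).** $\mathrm{OPT}(\text{LP-MUHV})(I)$ is the optimum value of: minimize $\sum_{j=1}^n w_jx_j$ subject to: $\sum_{i=1}^k y_j^i=1$ for all $v_j\in V$; $y_j^i=1$ whenever $c(v_j)=i$; $x_j^i\ge y_j^i-y_h^i$ for all $v_j\in V$, $v_h\in N(v_j)$, $i\in C$; $x_j=\sum_{i=1}^k x_j^i$ for all $v_j\in V$; and $y_j^i,x_j^i,x_j\ge0$. Here $N(v_j)$ is the set of neighbors of $v_j$. *)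

theory Defs
  imports Complex_Main "HOL-Library.FuncSet" "HOL-Library.Extended_Real"
begin

text \<open>The vertex \<open>v\<^sub>j\<close> is represented by its index \<open>j \<in> {1..n}\<close>; edges are two-element sets of vertices.\<close>

record muhv_instance =
  num_verts :: nat
  edges :: "nat set set"
  weight :: "nat \<Rightarrow> real"
  precol :: "nat \<Rightarrow> nat option"

definition verts :: "muhv_instance \<Rightarrow> nat set" where
  "verts I = {1..num_verts I}"

definition colors :: "nat \<Rightarrow> nat set" where
  "colors k = {1..k}"

definition nbrs :: "muhv_instance \<Rightarrow> nat \<Rightarrow> nat set" where
  "nbrs I v = {u. {u, v} \<in> edges I}"

text \<open>The condition \<open>ran (precol I) = colors k\<close> says both that the partial coloring takes its
  values in the color set and that every color is used on some vertex.\<close>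

definition is_muhv_instance :: "nat \<Rightarrow> muhv_instance \<Rightarrow> bool" where
  "is_muhv_instance k I \<longleftrightarrow>
     edges I \<subseteq> {e. e \<subseteq> verts I \<and> card e = 2} \<and>
     (\<forall>v\<in>verts I. 0 \<le> weight I v) \<and>
     dom (precol I) \<subseteq> verts I \<and>
     ran (precol I) = colors k"

definition extending_colorings :: "nat \<Rightarrow> muhv_instance \<Rightarrow> (nat \<Rightarrow> nat) set" where
  "extending_colorings k I =
     {f \<in> verts I \<rightarrow>\<^sub>E colors k. \<forall>v\<in>verts I. \<forall>i. precol I v = Some i \<longrightarrow> f v = i}"

definition unhappy :: "muhv_instance \<Rightarrow> (nat \<Rightarrow> nat) \<Rightarrow> nat set" where
  "unhappy I f = {v \<in> verts I. \<exists>u\<in>nbrs I v. f u \<noteq> f v}"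

definition opt_muhv :: "nat \<Rightarrow> muhv_instance \<Rightarrow> real" where
  "opt_muhv k I = Min ((\<lambda>f. \<Sum>v\<in>unhappy I f. weight I v) ` extending_colorings k I)"

text \<open>Here \<open>y j i\<close>, \<open>x j i\<close> and \<open>xs j\<close> stand for \<open>y\<^sub>j\<^sup>i\<close>, \<open>x\<^sub>j\<^sup>i\<close> and \<open>x\<^sub>j\<close>.\<close>

definition lp_feasible ::
  "nat \<Rightarrow> muhv_instance \<Rightarrow> (nat \<Rightarrow> nat \<Rightarrow> real) \<Rightarrow> (nat \<Rightarrow> nat \<Rightarrow> real) \<Rightarrow> (nat \<Rightarrow> real) \<Rightarrow> bool" where
  "lp_feasible k I y x xs \<longleftrightarrow>
     (\<forall>j\<in>verts I. (\<Sum>i\<in>colors k. y j i) = 1) \<and>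
     (\<forall>j\<in>verts I. \<forall>i\<in>colors k. precol I j = Some i \<longrightarrow> y j i = 1) \<and>
     (\<forall>j\<in>verts I. \<forall>h\<in>nbrs I j. \<forall>i\<in>colors k. x j i \<ge> y j i - y h i) \<and>
     (\<forall>j\<in>verts I. xs j = (\<Sum>i\<in>colors k. x j i)) \<and>
     (\<forall>j\<in>verts I. \<forall>i\<in>colors k. 0 \<le> y j i \<and> 0 \<le> x j i) \<and>
     (\<forall>j\<in>verts I. 0 \<le> xs j)"

definition lp_values :: "nat \<Rightarrow> muhv_instance \<Rightarrow> real set" where
  "lp_values k I = {\<Sum>j\<in>verts I. weight I j * xs j | y x xs. lp_feasible k I y x xs}"

text \<open>For \<open>k \<ge> 1\<close> the program is feasible with objective bounded below by 0 (see the lemmas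
  below), so this real infimum is the optimum value of the linear program.\<close>

definition opt_lp_muhv :: "nat \<Rightarrow> muhv_instance \<Rightarrow> real" where
  "opt_lp_muhv k I = Inf (lp_values k I)"

text \<open>The supremum is taken in the extended reals, so that no boundedness has to be presupposed.\<close>

definition integrality_gap :: "nat \<Rightarrow> ereal" where
  "integrality_gap k =
     (SUP I \<in> {I. is_muhv_instance k I \<and> opt_lp_muhv k I > 0}.
        ereal (opt_muhv k I / opt_lp_muhv k I))"

lemma finite_extending_colorings: "finite (extending_colorings k I)"
proof -
  have "finite (verts I \<rightarrow>\<^sub>E colors k)"
    by (intro finite_PiE) (auto simp: verts_def colors_def)
  then show ?thesis
    unfolding extending_colorings_def by (rule rev_finite_subset) auto
qed

lemma extending_colorings_nonempty:
  assumes "is_muhv_instance k I" "k \<ge> 1"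
  shows "extending_colorings k I \<noteq> {}"
proof -
  have "i \<in> colors k" if "precol I v = Some i" for v i
    using assms(1) that by (auto simp: is_muhv_instance_def intro: ranI)
  then have "(\<lambda>v\<in>verts I. case precol I v of None \<Rightarrow> 1 | Some i \<Rightarrow> i) \<in> extending_colorings k I"
    using assms(2) by (auto simp: extending_colorings_def colors_def split: option.splits)
  then show ?thesis by blast
qed

lemma lp_values_nonneg:
  assumes "is_muhv_instance k I" "z \<in> lp_values k I"
  shows "0 \<le> z"
  using assms by (auto simp: lp_values_def is_muhv_instance_def lp_feasible_def intro!: sum_nonneg)

lemma bdd_below_lp_values: "is_muhv_instance k I \<Longrightarrow> bdd_below (lp_values k I)"
  by (meson bdd_belowI lp_values_nonneg)

lemma nbrs_subset: "is_muhv_instance k I \<Longrightarrow> nbrs I v \<subseteq> verts I"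
  by (auto simp: nbrs_def is_muhv_instance_def)

text \<open>The integral point of an extending coloring, with \<open>x j i = 1\<close> exactly when \<open>v\<^sub>j\<close> is unhappy
  and has color \<open>i\<close>, is feasible and has the weight of the coloring as objective value.\<close>

lemma coloring_weight_in_lp_values:
  assumes I: "is_muhv_instance k I" and f: "f \<in> extending_colorings k I"
  shows "(\<Sum>v\<in>unhappy I f. weight I v) \<in> lp_values k I"
proof -
  define y :: "nat \<Rightarrow> nat \<Rightarrow> real" where "y j i = (if f j = i then 1 else 0)" for j i
  define x :: "nat \<Rightarrow> nat \<Rightarrow> real" where
    "x j i = (if f j = i \<and> j \<in> unhappy I f then 1 else 0)" for j i
  define xs where "xs j = (\<Sum>i\<in>colors k. x j i)" for j
  have fC: "f j \<in> colors k" if "j \<in> verts I" for j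
    using f that by (auto simp: extending_colorings_def)
  have fin: "finite (colors k)" "finite (verts I)"
    by (auto simp: colors_def verts_def)
  have xs: "xs j = (if j \<in> unhappy I f then 1 else 0)" if "j \<in> verts I" for j
    using fC[OF that] fin by (cases "j \<in> unhappy I f") (auto simp: xs_def x_def)
  have "lp_feasible k I y x xs"
    using fC fin f xs
    by (auto simp: lp_feasible_def y_def x_def xs_def extending_colorings_def unhappy_def)
  moreover have "(\<Sum>j\<in>verts I. weight I j * xs j) = (\<Sum>v\<in>unhappy I f. weight I v)"
  proof -
    have "(\<Sum>j\<in>verts I. weight I j * xs j)
        = (\<Sum>j\<in>verts I. if j \<in> unhappy I f then weight I j else 0)"
      by (intro sum.cong) (auto simp: xs)
    also have "\<dots> = (\<Sum>j\<in>verts I \<inter> unhappy I f. weight I j)"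
      by (rule sum.inter_restrict[symmetric]) (rule fin)
    also have "verts I \<inter> unhappy I f = unhappy I f"
      by (auto simp: unhappy_def)
    finally show ?thesis .
  qed
  ultimately show ?thesis
    unfolding lp_values_def by force
qed

lemma lp_values_nonempty:
  "is_muhv_instance k I \<Longrightarrow> k \<ge> 1 \<Longrightarrow> lp_values k I \<noteq> {}"
  using coloring_weight_in_lp_values extending_colorings_nonempty by blast

end

(* The gap is attained by the subdivided complete graph: terminals 1..k of weight 1, terminal a
   precolored a, and for each pair (a, b) a vertex of weight 0 adjacent to a and b. Two distinct
   terminals cannot both be happy, since their common neighbor would need both colors; hence every
   coloring costs at least k - 1. Fractionally, the vertex of (a, b) takes half of color a and half
   of color b, so each terminal pays 1/2 and the LP costs at most k/2. *)
theory Submission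
  imports Defs
begin

text \<open>The pair \<open>(a, b)\<close> with \<open>a, b \<in> {1..k}\<close> is encoded as the vertex \<open>a * k + b\<close>, which lies in
  \<open>{k + 1..k + k * k}\<close>. The diagonal pairs \<open>(a, a)\<close> are kept; they give harmless pendant vertices.\<close>

definition end1 :: "nat \<Rightarrow> nat \<Rightarrow> nat" where
  "end1 k v = (v - 1) div k"

definition end2 :: "nat \<Rightarrow> nat \<Rightarrow> nat" where
  "end2 k v = (v - 1) mod k + 1"

definition gap_instance :: "nat \<Rightarrow> muhv_instance" where
  "gap_instance k =
     \<lparr>num_verts = k + k * k,
      edges = {{a, v} | a v. a \<in> {1..k} \<and> v \<in> {k + 1..k + k * k} \<and> (a = end1 k v \<or> a = end2 k v)},
      weight = (\<lambda>v. if v \<le> k then 1 else 0),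
      precol = (\<lambda>v. if v \<in> {1..k} then Some v else None)\<rparr>"

text \<open>Since \<open>b\<close> starts at 1, \<open>a * k + b - 1\<close> has quotient
  \<open>a\<close> and remainder \<open>b - 1\<close> modulo \<open>k\<close>; hence the shift by 1
  before dividing. Without it, \<open>b = k\<close> would spill into the next block.\<close>

lemma end1_encode:
  assumes "b \<in> {1..k}"
  shows "end1 k (a * k + b) = a"
  using assms by (cases b) (auto simp: end1_def)

lemma end2_encode:
  assumes "b \<in> {1..k}"
  shows "end2 k (a * k + b) = b"
  using assms by (cases b) (auto simp: end2_def)

lemma encode_range:
  fixes a b k :: nat
  assumes "a \<in> {1..k}" "b \<in> {1..k}"
  shows "a * k + b \<in> {k + 1..k + k * k}"
proof -
  \<comment> \<open>These two products are the only nonlinear input; the rest is linear in the atoms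
    \<open>a * k\<close> and \<open>k * k\<close>.\<close>
  have "1 * k \<le> a * k" "a * k \<le> k * k"
    using assms by auto
  then show ?thesis using assms unfolding atLeastAtMost_iff by linarith
qed

lemma end1_range:
  assumes "v \<in> {k + 1..k + k * k}"
  shows "end1 k v \<in> {1..k}"
proof -
  have k: "k > 0" using assms by (cases k) auto
  have "v - 1 < (k + 1) * k" "k \<le> v - 1" using assms by auto
  then have "(v - 1) div k < k + 1" "1 \<le> (v - 1) div k"
    using k by (auto simp: less_mult_imp_div_less div_greater_zero_iff Suc_le_eq)
  then show ?thesis by (auto simp: end1_def)
qed

lemma end2_range: "k > 0 \<Longrightarrow> end2 k v \<in> {1..k}"
  by (auto simp: end2_def Suc_le_eq)

lemma nbrs_gap_instance_terminal:
  "v \<le> k \<Longrightarrow> u \<in> nbrs (gap_instance k) v \<Longrightarrow> k < u \<and> (v = end1 k u \<or> v = end2 k u)"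
  by (auto simp: nbrs_def gap_instance_def doubleton_eq_iff)

lemma encode_in_nbrs:
  assumes "a \<in> {1..k}" "b \<in> {1..k}"
  shows "a * k + b \<in> nbrs (gap_instance k) a" "a * k + b \<in> nbrs (gap_instance k) b"
proof -
  have "{a * k + b, c} \<in> edges (gap_instance k)" if "c = a \<or> c = b" for c
  proof -
    have "{a * k + b, c} = {c, a * k + b}" by (rule insert_commute)
    moreover have "c \<in> {1..k}" using that assms by blast
    moreover have "c = end1 k (a * k + b) \<or> c = end2 k (a * k + b)"
      using that by (simp only: end1_encode[OF assms(2)] end2_encode[OF assms(2)])
    ultimately show ?thesis
      using encode_range[OF assms] unfolding gap_instance_def muhv_instance.simps by blast
  qed
  then show "a * k + b \<in> nbrs (gap_instance k) a" "a * k + b \<in> nbrs (gap_instance k) b"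
    by (auto simp: nbrs_def)
qed

lemma is_muhv_instance_gap_instance: "is_muhv_instance k (gap_instance k)"
proof -
  have "e \<subseteq> verts (gap_instance k) \<and> card e = 2" if e: "e \<in> edges (gap_instance k)" for e
  proof -
    obtain a v where "e = {a, v}" "a \<in> {1..k}" "v \<in> {k + 1..k + k * k}"
      using e unfolding gap_instance_def muhv_instance.simps by blast
    moreover from this have "a \<noteq> v" by simp
    ultimately show ?thesis by (simp add: verts_def gap_instance_def)
  qed
  moreover have "ran (precol (gap_instance k)) = colors k"
  proof -
    have "precol (gap_instance k) v = Some i \<longleftrightarrow> v = i \<and> i \<in> {1..k}" for v i
      by (auto simp: gap_instance_def split: if_splits)
    then show ?thesis
      unfolding ran_def colors_def by blast
  qed
  moreover have "\<forall>v\<in>verts (gap_instance k). 0 \<le> weight (gap_instance k) v"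
    by (simp add: gap_instance_def)
  moreover have "dom (precol (gap_instance k)) \<subseteq> verts (gap_instance k)"
    by (auto simp: verts_def gap_instance_def split: if_splits)
  ultimately show ?thesis
    unfolding is_muhv_instance_def by blast
qed

lemma verts_gap_instance: "verts (gap_instance k) = {1..k + k * k}"
  by (simp add: verts_def gap_instance_def)

text \<open>The weight is the indicator of the terminals. The free factor \<open>g\<close> lets this
  serve both the integral cost (\<open>g\<close> constantly 1) and the LP objective
  (\<open>g = xs\<close>).\<close>

lemma sum_weight_gap_instance:
  assumes "A \<subseteq> verts (gap_instance k)"
  shows "(\<Sum>v\<in>A. weight (gap_instance k) v * g v) = sum g (A \<inter> {1..k})"
proof -
  have "finite A" using finite_subset[OF assms] by (simp add: verts_gap_instance)
  then have "sum g (A \<inter> {1..k}) = (\<Sum>v\<in>A. if v \<in> {1..k} then g v else 0)"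
    by (rule sum.inter_restrict)
  also have "\<dots> = (\<Sum>v\<in>A. weight (gap_instance k) v * g v)"
    using assms by (intro sum.cong) (auto simp: gap_instance_def verts_def)
  finally show ?thesis by simp
qed

lemma opt_muhv_gap_instance_ge:
  assumes "k \<ge> 1"
  shows "real k - 1 \<le> opt_muhv k (gap_instance k)"
proof -
  let ?I = "gap_instance k"
  have "real k - 1 \<le> (\<Sum>v\<in>unhappy ?I f. weight ?I v)" if f: "f \<in> extending_colorings k ?I" for f
  proof -
    define H where "H = {1..k} - unhappy ?I f"
    have ext: "f a = a" if "a \<in> {1..k}" for a
      using f that by (auto simp: extending_colorings_def gap_instance_def verts_def)
    \<comment> \<open>A happy terminal forces its precolored color onto all its neighbors.\<close>
    have common: "f u = a" if "a \<in> H" "u \<in> nbrs ?I a" for a u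
      using that ext by (auto simp: H_def unhappy_def verts_gap_instance)
    have "a = b" if "a \<in> H" "b \<in> H" for a b
    proof -
      have ab: "a \<in> {1..k}" "b \<in> {1..k}" using that by (auto simp: H_def)
      \<comment> \<open>The vertex encoding \<open>(a, b)\<close> gets both colors \<open>a\<close>
        and \<open>b\<close>. Keeping the diagonal pairs spares a case split on
        \<open>a = b\<close>.\<close>
      then show ?thesis
        using common[OF that(1) encode_in_nbrs(1)[OF ab]] common[OF that(2) encode_in_nbrs(2)[OF ab]]
        by simp
    qed
    then have "card H \<le> 1"
      by (simp add: H_def card_le_Suc0_iff_eq)
    moreover have "card {1..k} = card (unhappy ?I f \<inter> {1..k}) + card H"
      using card_Int_Diff[of "{1..k}" "unhappy ?I f"] by (simp add: H_def Int_commute)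
    moreover have "(\<Sum>v\<in>unhappy ?I f. weight ?I v) = card (unhappy ?I f \<inter> {1..k})"
      using sum_weight_gap_instance[of "unhappy ?I f" k "\<lambda>_. 1"] by (simp add: unhappy_def)
    ultimately show ?thesis by simp
  qed
  then show ?thesis
    unfolding opt_muhv_def
    using extending_colorings_nonempty[OF is_muhv_instance_gap_instance assms]
      finite_extending_colorings[of k ?I]
    by (subst Min_ge_iff) auto
qed

lemma opt_lp_muhv_gap_instance_le:
  assumes "k \<ge> 1"
  shows "opt_lp_muhv k (gap_instance k) \<le> real k / 2"
proof -
  let ?I = "gap_instance k"
  define d :: "nat \<Rightarrow> nat \<Rightarrow> real" where "d a i = (if i = a then 1 else 0)" for a i
  define y where "y v i = (if v \<le> k then d v i else (d (end1 k v) i + d (end2 k v) i) / 2)" for v i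
  \<comment> \<open>The pair vertices have weight 0, so they may take the trivially sufficient value 1.\<close>
  define x where "x v i = (if v \<le> k then d v i / 2 else 1)" for v i
  define xs where "xs v = (\<Sum>i\<in>colors k. x v i)" for v
  have sum_d: "(\<Sum>i\<in>colors k. d a i) = 1" if "a \<in> {1..k}" for a
    using that by (simp add: d_def colors_def)
  have x0: "0 \<le> x v i" for v i
    by (simp add: x_def d_def)
  have y01: "0 \<le> y v i" "y v i \<le> 1" for v i
    by (auto simp: y_def d_def)
  have "(\<Sum>i\<in>colors k. y v i) = 1" if "v \<in> verts ?I" for v
  proof (cases "v \<le> k")
    case True
    then show ?thesis using that sum_d[of v] by (auto simp: y_def verts_gap_instance)
  next
    case False
    then have "end1 k v \<in> {1..k}" "end2 k v \<in> {1..k}"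
      using that end1_range[of v k] end2_range[of k v] assms by (auto simp: verts_gap_instance)
    then show ?thesis
      using False by (simp add: y_def sum.distrib sum_d flip: sum_divide_distrib)
  qed
  moreover have "y v i - y u i \<le> x v i" if "u \<in> nbrs ?I v" for u v i
  proof (cases "v \<le> k")
    case True
    \<comment> \<open>In its own color the terminal has value 1 and each neighbor at least 1/2; in
      every other color the terminal has value 0.\<close>
    then show ?thesis
      using nbrs_gap_instance_terminal[OF True that] by (auto simp: y_def x_def d_def)
  next
    case False
    then show ?thesis using y01(1)[of u i] y01(2)[of v i] by (simp add: x_def)
  qed
  moreover have "y v i = 1" if "precol ?I v = Some i" for v i
    using that by (auto simp: gap_instance_def y_def d_def split: if_splits)
  ultimately have "lp_feasible k ?I y x xs"
    using x0 y01 by (auto simp: lp_feasible_def xs_def intro!: sum_nonneg)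
  then have "(\<Sum>v\<in>verts ?I. weight ?I v * xs v) \<in> lp_values k ?I"
    unfolding lp_values_def by blast
  moreover have "(\<Sum>v\<in>verts ?I. weight ?I v * xs v) = real k / 2"
  proof -
    have "(\<Sum>v\<in>verts ?I. weight ?I v * xs v) = sum xs {1..k}"
      by (simp add: sum_weight_gap_instance) (auto simp: verts_gap_instance intro: sum.cong)
    also have "\<dots> = (\<Sum>v\<in>{1..k}. 1 / 2)"
      by (intro sum.cong) (auto simp: xs_def x_def sum_d simp flip: sum_divide_distrib)
    finally show ?thesis by simp
  qed
  ultimately show ?thesis
    unfolding opt_lp_muhv_def
    by (metis cInf_lower bdd_below_lp_values is_muhv_instance_gap_instance)
qed

text \<open>This admits the instance to the supremum. As the LP optimum is an infimum, positivity of
  each value would not suffice, so a uniform bound is shown: a common neighbor of terminals 1 and 2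
  has total mass 1 to share between their colors, so together these terminals pay at least 2 -
  1.\<close>

lemma opt_lp_muhv_gap_instance_ge_1:
  assumes "k \<ge> 2"
  shows "1 \<le> opt_lp_muhv k (gap_instance k)"
  unfolding opt_lp_muhv_def
proof (rule cInf_greatest)
  show "lp_values k (gap_instance k) \<noteq> {}"
    using lp_values_nonempty[OF is_muhv_instance_gap_instance] assms by simp
next
  let ?I = "gap_instance k"
  fix z assume "z \<in> lp_values k ?I"
  then obtain y x xs where z: "z = (\<Sum>j\<in>verts ?I. weight ?I j * xs j)"
    and F: "lp_feasible k ?I y x xs"
    unfolding lp_values_def by blast
  \<comment> \<open>The vertex of the pair (1, 2), in the form \<open>a * k + b\<close> of the
    encoding lemmas.\<close>
  define u where "u = 1 * k + (2::nat)"
  have u: "u \<in> nbrs ?I 1" "u \<in> nbrs ?I 2" "u \<in> verts ?I"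
    using encode_in_nbrs[of 1 k 2] encode_range[of 1 k 2] assms
    by (auto simp: u_def verts_gap_instance)
  have V: "{1..k} \<subseteq> verts ?I" "{1, 2} \<subseteq> {1..k}" "{1, 2} \<subseteq> colors k"
    using assms by (auto simp: verts_gap_instance colors_def)
  have xs_ge: "1 - y u a \<le> xs a" if "a \<in> {1, 2}" for a
  proof -
    have a: "a \<in> verts ?I" "a \<in> colors k" "a \<in> {1..k}" "u \<in> nbrs ?I a" using V u that by auto
    have "y a a = 1"
      using F a by (auto simp: lp_feasible_def gap_instance_def)
    then have "1 - y u a \<le> x a a"
      using F a unfolding lp_feasible_def by metis
    also have "\<dots> \<le> (\<Sum>i\<in>colors k. x a i)"
      using F a by (intro member_le_sum) (auto simp: lp_feasible_def colors_def)
    also have "\<dots> = xs a" using F a by (simp add: lp_feasible_def)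
    finally show ?thesis .
  qed
  have "(\<Sum>i\<in>{1, 2}. y u i) \<le> (\<Sum>i\<in>colors k. y u i)"
    using F u(3) V(3) by (intro sum_mono2) (auto simp: lp_feasible_def colors_def)
  then have "y u 1 + y u 2 \<le> 1"
    using F u(3) by (simp add: lp_feasible_def)
  then have "1 \<le> (\<Sum>a\<in>{1, 2}. xs a)"
    using xs_ge[of 1] xs_ge[of 2] by simp
  also have "\<dots> \<le> sum xs {1..k}"
    using F V by (intro sum_mono2) (auto simp: lp_feasible_def)
  also have "\<dots> = z"
    using V(1) by (simp add: z sum_weight_gap_instance Int_absorb1)
  finally show "1 \<le> z" .
qed

theorem theorem11:
  fixes k :: nat
  assumes "k \<ge> 2"
  shows "integrality_gap k \<ge> ereal (2 - 2 / real k)"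
proof -
  let ?I = "gap_instance k"
  have lp: "0 < opt_lp_muhv k ?I" "opt_lp_muhv k ?I \<le> real k / 2"
    using opt_lp_muhv_gap_instance_ge_1[OF assms] opt_lp_muhv_gap_instance_le[of k] assms by auto
  \<comment> \<open>The integral lower bound \<open>k - 1\<close> over the fractional upper bound
    \<open>k / 2\<close>.\<close>
  have "2 - 2 / real k = (real k - 1) / (real k / 2)"
    using assms by (simp add: field_simps)
  also have "\<dots> \<le> opt_muhv k ?I / opt_lp_muhv k ?I"
    using opt_muhv_gap_instance_ge[of k] lp assms by (intro frac_le) auto
  finally have "ereal (2 - 2 / real k) \<le> ereal (opt_muhv k ?I / opt_lp_muhv k ?I)"
    by simp
  also have "\<dots> \<le> integrality_gap k"
    unfolding integrality_gap_def
    using lp(1) is_muhv_instance_gap_instance by (intro SUP_upper) simp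
  finally show ?thesis .
qed

end
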